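(* Let $X,Y\subset \mathbb{R}^n$ be two closed convex sets with nonempty intersection. For any $z\in \mathbb{R}^n$ set $z_{\mathrm{MAP}}:= P_YP_X(z)$. Then $z_{C}:= \tfrac{1}{2} \left( z_{\mathrm{MAP}} + P_{X}(z_{\mathrm{MAP}}) \right)$ is centralized with respect to $X,Y$. Moreover, $z_{C}$ is either strictly centralized or it belongs to $X\cap Y$.
   Context: $P_X,P_Y$ denote the orthogonal projections onto $X,Y$ in $\mathbb{R}^n$ with the Euclidean inner product $\langle\cdot,\cdot\rangle$, and $R_X:=2P_X-\mathrm{Id}$, $R_Y:=2P_Y-\mathrm{Id}$. A point $z\in\mathbb{R}^n$ is centralized with respect to $X,Y$ if $\langle R_X(z)-z,R_Y(z)-z\rangle\le 0$. A centralized point is called strictly centralized if it is neither in $X$ nor in $Y$. *)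

theory Defs
  imports "HOL-Analysis.Analysis"
begin

text \<open>
  The orthogonal projection onto a set is the library's \<^const>\<open>closest_point\<close>. It is the
  genuine (unique) projection when the set is nonempty, closed and convex; these conditions are
  hypotheses of the results and are not built into the definitions below.
\<close>

definition reflection :: "(real ^ 'n) set \<Rightarrow> real ^ 'n \<Rightarrow> real ^ 'n" where
  "reflection X z = 2 *\<^sub>R closest_point X z - z"

definition centralized :: "(real ^ 'n) set \<Rightarrow> (real ^ 'n) set \<Rightarrow> real ^ 'n \<Rightarrow> bool" where
  "centralized X Y z \<longleftrightarrow> (reflection X z - z) \<bullet> (reflection Y z - z) \<le> 0"

definition strictly_centralized :: "(real ^ 'n) set \<Rightarrow> (real ^ 'n) set \<Rightarrow> real ^ 'n \<Rightarrow> bool" where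
  "strictly_centralized X Y z \<longleftrightarrow> centralized X Y z \<and> z \<notin> X \<and> z \<notin> Y"

text \<open>One step of alternating projections: first onto \<open>X\<close>, then onto \<open>Y\<close>.\<close>

definition z_MAP :: "(real ^ 'n) set \<Rightarrow> (real ^ 'n) set \<Rightarrow> real ^ 'n \<Rightarrow> real ^ 'n" where
  "z_MAP X Y z = closest_point Y (closest_point X z)"

definition z_C :: "(real ^ 'n) set \<Rightarrow> (real ^ 'n) set \<Rightarrow> real ^ 'n \<Rightarrow> real ^ 'n" where
  "z_C X Y z = (1/2) *\<^sub>R (z_MAP X Y z + closest_point X (z_MAP X Y z))"

end

theory Submission
  imports Defs
begin

text \<open>
  Write \<open>p\<close> for the projection of \<open>z\<close> onto \<open>X\<close>, \<open>y\<close> for the projection of \<open>p\<close> onto \<open>Y\<close>,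
  \<open>x\<close> for the projection of \<open>y\<close> onto \<open>X\<close>, and \<open>c\<close> for the midpoint of \<open>x\<close> and \<open>y\<close>. Everything
  rests on the variational inequality of projections, \<^term>\<open>(a - closest_point S a) \<bullet>
  (s - closest_point S a) \<le> 0\<close> for \<open>s\<close> in \<open>S\<close>.

  A point on the segment from \<open>y\<close> to \<open>x\<close> projects onto \<open>X\<close> at \<open>x\<close>
  (\<open>closest_point_on_normal_ray\<close>), so the displacement of \<open>c\<close>
  under the reflection in \<open>X\<close> is \<open>x - y\<close>, which points straight away from the point \<open>y\<close> of \<open>Y\<close>.
  But the step from \<open>c\<close> to its projection onto \<open>Y\<close> never forms an obtuse angle with the
  direction from \<open>c\<close> to a point of \<open>Y\<close> (\<open>closest_point_displacement_dot\<close>), so the displacements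
  for \<open>X\<close> and for \<open>Y\<close> cannot form an acute angle; hence \<open>c\<close> is centralized.

  For strictness, suppose that \<open>c\<close> lies in \<open>X\<close> or in \<open>Y\<close>; it must be shown that \<open>x = y\<close>, since then
  \<open>c\<close> is this common point. If \<open>c\<close> lies in \<open>X\<close>, the projection of \<open>y\<close> cannot stop at \<open>x\<close> when \<open>c\<close>
  is closer. If \<open>c\<close> lies in \<open>Y\<close>, the variational inequality for \<open>y\<close> says that the angle at \<open>y\<close>
  between \<open>p\<close> and \<open>x\<close> is not acute, whereas the one for \<open>x\<close>, tested with the point \<open>p\<close> of \<open>X\<close>,
  says that the angle at \<open>x\<close> between \<open>y\<close> and \<open>p\<close> is not acute either; a nondegenerate triangle
  has no two such angles (\<open>two_nonacute_angles_imp_eq\<close>).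
\<close>

text \<open>
  Going from \<open>b\<close> in the direction \<open>a - b\<close> keeps \<open>b\<close> closest because no point of \<open>S\<close> lies strictly
  on that side of \<open>b\<close>: in the expansion of the squared distance to a point \<open>s\<close> of \<open>S\<close>, the mixed
  term can only increase it. For \<open>t = 1/2\<close> this locates the projection of the midpoint of \<open>a\<close>
  and \<open>b\<close>.
\<close>
lemma closest_point_on_normal_ray:
  fixes a :: "'a::euclidean_space"
  assumes "closed S" "convex S" "S \<noteq> {}" "0 \<le> t"
  defines "b \<equiv> closest_point S a"
  shows "closest_point S (b + t *\<^sub>R (a - b)) = b"
proof (rule closest_point_unique[symmetric])
  show "b \<in> S" using closest_point_in_set assms by blast
  show "\<forall>s\<in>S. dist (b + t *\<^sub>R (a - b)) b \<le> dist (b + t *\<^sub>R (a - b)) s"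
  proof
    fix s assume "s \<in> S"
    then have "(a - b) \<bullet> (s - b) \<le> 0"
      using closest_point_dot assms by blast
    then have "t * ((a - b) \<bullet> (s - b)) \<le> 0"
      using \<open>0 \<le> t\<close> by (simp add: mult_nonneg_nonpos)
    moreover have "norm (t *\<^sub>R (a - b) - (s - b)) ^ 2 =
      norm (t *\<^sub>R (a - b)) ^ 2 + norm (s - b) ^ 2 - 2 * (t * ((a - b) \<bullet> (s - b)))"
      by (simp only: power2_norm_eq_inner inner_diff_left inner_diff_right inner_scaleR_left
          inner_scaleR_right inner_commute)
    ultimately have "norm (t *\<^sub>R (a - b)) ^ 2 \<le> norm (t *\<^sub>R (a - b) - (s - b)) ^ 2"
      using zero_le_power2[of "norm (s - b)"] by linarith
    then have "norm (t *\<^sub>R (a - b)) \<le> norm (t *\<^sub>R (a - b) - (s - b))"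
      by (rule power2_le_imp_le) simp
    then show "dist (b + t *\<^sub>R (a - b)) b \<le> dist (b + t *\<^sub>R (a - b)) s"
      by (simp add: dist_norm algebra_simps)
  qed
qed (use assms in auto)

text \<open>
  With \<open>q\<close> the projection of \<open>a\<close>, split \<open>s - a\<close> at \<open>q\<close>: the part \<open>q - a\<close> contributes the squared
  distance of \<open>a\<close> from \<open>S\<close>, and the part \<open>s - q\<close> contributes a nonnegative amount by the
  variational inequality.
\<close>
lemma closest_point_displacement_dot:
  fixes a :: "'a::euclidean_space"
  assumes "closed S" "convex S" "s \<in> S"
  shows "0 \<le> (s - a) \<bullet> (closest_point S a - a)"
proof -
  define q where "q = closest_point S a"
  have "(a - q) \<bullet> (s - q) \<le> 0"
    unfolding q_def by (rule closest_point_dot[OF assms(2,1,3)])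
  moreover have "(s - a) \<bullet> (q - a) = (q - a) \<bullet> (q - a) - (a - q) \<bullet> (s - q)"
    by (simp add: inner_diff_left inner_diff_right inner_commute)
  ultimately show ?thesis
    using inner_ge_zero[of "q - a"] unfolding q_def by linarith
qed

text \<open>
  The two inner products add up to the squared length of the side from \<open>x\<close> to \<open>y\<close>, so the angles
  at both of its ends can fail to be acute only if it vanishes.
\<close>
lemma two_nonacute_angles_imp_eq:
  fixes p x y :: "'a::real_inner"
  assumes "(y - x) \<bullet> (p - x) \<le> 0" "(p - y) \<bullet> (x - y) \<le> 0"
  shows "x = y"
proof -
  have "(x - y) \<bullet> (x - y) = (y - x) \<bullet> (p - x) + (p - y) \<bullet> (x - y)"
    by (simp add: inner_diff_left inner_diff_right inner_commute)
  with assms have "(x - y) \<bullet> (x - y) \<le> 0" by linarith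
  then show ?thesis by (metis inner_gt_zero_iff not_less right_minus_eq)
qed

theorem lemma2p2:
  fixes X Y :: "(real ^ 'n) set" and z :: "real ^ 'n"
  assumes "closed X" and "convex X"
    and "closed Y" and "convex Y"
    and "X \<inter> Y \<noteq> {}"
  shows "centralized X Y (z_C X Y z) \<and>
         (strictly_centralized X Y (z_C X Y z) \<or> z_C X Y z \<in> X \<inter> Y)"
proof -
  define p where "p = closest_point X z"
  define y where "y = closest_point Y p"
  define x where "x = closest_point X y"
  define c where "c = z_C X Y z"
  have c: "c = (1/2) *\<^sub>R (y + x)"
    by (simp add: c_def z_C_def z_MAP_def x_def y_def p_def)
  have ne: "X \<noteq> {}" "Y \<noteq> {}" using assms(5) by auto
  have p: "p \<in> X" and y: "y \<in> Y" and x: "x \<in> X"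
    unfolding p_def y_def x_def using closest_point_in_set assms ne by blast+
  have x_dot: "(y - x) \<bullet> (s - x) \<le> 0" if "s \<in> X" for s
    unfolding x_def by (rule closest_point_dot[OF assms(2,1) that])
  have y_dot: "(p - y) \<bullet> (s - y) \<le> 0" if "s \<in> Y" for s
    unfolding y_def by (rule closest_point_dot[OF assms(4,3) that])
  have c_x: "c - x = (1/2) *\<^sub>R (y - x)" and c_y: "c - y = (1/2) *\<^sub>R (x - y)"
    unfolding c by (simp_all add: vec_eq_iff field_simps)
  have "closest_point X c = x"
    using closest_point_on_normal_ray[OF assms(1,2) ne(1), of "1/2" y] c_x
    by (simp add: x_def[symmetric] diff_eq_eq add.commute)
  then have X_displacement: "reflection X c - c = (-2) *\<^sub>R (y - c)"
    unfolding reflection_def c by (simp add: vec_eq_iff field_simps)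
  have Y_displacement: "reflection Y c - c = 2 *\<^sub>R (closest_point Y c - c)"
    unfolding reflection_def by (simp add: vec_eq_iff)
  have cent: "centralized X Y c"
    using closest_point_displacement_dot[OF assms(3,4) y, of c]
    unfolding centralized_def X_displacement Y_displacement
    by (simp only: inner_scaleR_left inner_scaleR_right)
  have "x = y" if "c \<in> X \<or> c \<in> Y"
    using that
  proof
    assume "c \<in> X"
    from x_dot[OF this] have "(y - x) \<bullet> (y - x) \<le> 0" by (simp add: c_x)
    then show ?thesis by (metis inner_gt_zero_iff not_less right_minus_eq)
  next
    assume "c \<in> Y"
    from y_dot[OF this] have "(p - y) \<bullet> (x - y) \<le> 0" by (simp add: c_y)
    with x_dot[OF p] show ?thesis by (rule two_nonacute_angles_imp_eq)
  qed
  then have "c \<in> X \<inter> Y" if "c \<in> X \<or> c \<in> Y"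
    using that x y c_x by auto
  with cent show ?thesis
    unfolding strictly_centralized_def c_def by blast
qed

end
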